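(* Let $\lambda>0$, let $m\le n$ be positive integers and let $1\le r\le m$. Then \[ \sup_{X_0\in M_{m,n},\ \operatorname{rank}(X_0)\le r} R(\hat X_\lambda,X_0)=\lim_{\mu\to\infty}R(\hat X_\lambda,\mu C), \] where $C\in M_{m,n}$ is any fixed matrix of rank exactly $r$.
   Context: $M_{m,n}$ denotes the set of real $m\times n$ matrices, $\|\cdot\|_F$ the Frobenius norm and $\|X\|_*$ the nuclear norm (sum of singular values). For $\lambda>0$, the singular value soft thresholding (SVST) estimator is $\hat X_\lambda(Y)=\operatorname{argmin}_{X\in M_{m,n}}\frac12\|Y-X\|_F^2+\lambda\|X\|_*$; equivalently, if $Y=U\,\mathrm{diag}(y_1,\dots,y_m)V^T$ is a singular value decomposition, then $\hat X_\lambda(Y)=U\,\mathrm{diag}((y_1-\lambda)_+,\dots,(y_m-\lambda)_+)V^T$. For a measurable map $\hat X:M_{m,n}\to M_{m,n}$ and $X_0\in M_{m,n}$, the risk is $R(\hat X,X_0)=\frac1m\mathbb E\|\hat X(X_0+\frac{1}{\sqrt n}Z)-X_0\|_F^2$, where $Z\in M_{m,n}$ has i.i.d. $\mathcal N(0,1)$ entries. *)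

theory Defs
  imports "HOL-Analysis.Analysis" "HOL-Probability.Probability"
begin

text \<open>Real m x n matrices are modelled as real^'n^'m (rows indexed by 'm, columns by 'n).
  The Euclidean norm on real^'n^'m is the Frobenius norm.\<close>

definition diag_mat :: "('m::finite \<Rightarrow> real) \<Rightarrow> real^'m^'m" where
  "diag_mat s = (\<chi> i j. if i = j then s i else 0)"

definition is_svd :: "real^'n^'m \<Rightarrow> real^'m^'m \<Rightarrow> ('m \<Rightarrow> real) \<Rightarrow> real^'m^'n \<Rightarrow> bool" where
  "is_svd X U s V \<longleftrightarrow> orthogonal_matrix U \<and> transpose V ** V = mat 1 \<and>
     (\<forall>i. 0 \<le> s i) \<and> X = U ** diag_mat s ** transpose V"

definition nuclear_norm :: "real^'n::finite^'m::finite \<Rightarrow> real" where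
  "nuclear_norm X = (THE t. \<exists>U s V. is_svd X U s V \<and> t = (\<Sum>i\<in>UNIV. s i))"

text \<open>Singular value soft thresholding estimator, defined as the minimiser.\<close>
definition svst :: "real \<Rightarrow> real^'n::finite^'m::finite \<Rightarrow> real^'n^'m" where
  "svst lam Y = (THE X. \<forall>X'. (1/2) * (norm (Y - X))\<^sup>2 + lam * nuclear_norm X
                            \<le> (1/2) * (norm (Y - X'))\<^sup>2 + lam * nuclear_norm X')"

definition gauss_matrix :: "(real^'n::finite^'m::finite) measure" where
  "gauss_matrix = density lborel (\<lambda>Z. ennreal (\<Prod>i\<in>UNIV. \<Prod>j\<in>UNIV. std_normal_density (Z $ i $ j)))"

definition risk :: "(real^'n::finite^'m::finite \<Rightarrow> real^'n^'m) \<Rightarrow> real^'n^'m \<Rightarrow> ennreal" where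
  "risk Xhat X0 = ennreal (1 / real CARD('m)) *
     (\<integral>\<^sup>+ Z. ennreal ((norm (Xhat (X0 + (1 / sqrt (real CARD('n))) *\<^sub>R Z) - X0))\<^sup>2) \<partial>gauss_matrix)"

end

theory Submission
  imports Defs
begin

text \<open>
  By Moreau's decomposition, svst l Y = Y - P Y, where P is the projection onto the ball of
  radius l in the spectral norm, so the loss at X with noise Z is |Z - P (X + Z)|^2. Along a ray
  X = mu C this is pointwise nondecreasing in mu, because P is a projection onto a convex set.
  As mu grows, P (mu C + Z) is pushed towards the face of the ball exposed by C, i.e. the loss
  tends to the squared distance from Z to that face. If X is diagonal in the singular vectors of C
  and has its support among the nonzero singular values of C, it exposes a larger face, so its loss is at most
  this limit. Rotation invariance of the Gaussian matrix reduces every X with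
  rank X at most rank C to this case, and monotone convergence passes to the risk.
\<close>

subsection \<open>Orthonormal families and the singular value decomposition\<close>

text \<open>Families over an explicit index set, not sets of vectors: singular values and both kinds
  of singular vectors share one index, and a family can grow one index at a time.\<close>

definition orthonormal_on :: "'i set \<Rightarrow> ('i \<Rightarrow> 'a::real_inner) \<Rightarrow> bool" where
  "orthonormal_on I e \<longleftrightarrow> (\<forall>i\<in>I. \<forall>j\<in>I. e i \<bullet> e j = (if i = j then 1 else 0))"

lemma orthonormal_onD:
  "orthonormal_on I e \<Longrightarrow> i \<in> I \<Longrightarrow> j \<in> I \<Longrightarrow> e i \<bullet> e j = (if i = j then 1 else 0)"
  by (auto simp: orthonormal_on_def)

lemma orthonormal_on_norm: "orthonormal_on I e \<Longrightarrow> i \<in> I \<Longrightarrow> norm (e i) = 1"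
  by (simp add: orthonormal_on_def norm_eq_sqrt_inner)

lemma orthonormal_on_inj:
  assumes "orthonormal_on I e" shows "inj_on e I"
proof (rule inj_onI)
  fix i j assume "i \<in> I" "j \<in> I" "e i = e j"
  then show "i = j" using orthonormal_onD[OF assms, of i j] orthonormal_onD[OF assms, of j j]
    by (auto split: if_splits)
qed

lemma orthonormal_on_independent:
  fixes e :: "'i \<Rightarrow> 'a::euclidean_space"
  assumes "orthonormal_on I e" shows "independent (e ` I)"
proof (rule pairwise_orthogonal_independent)
  show "pairwise orthogonal (e ` I)"
    using assms by (fastforce simp: pairwise_def orthogonal_def orthonormal_on_def)
  show "0 \<notin> e ` I" using orthonormal_on_norm[OF assms] by fastforce
qed

lemma orthonormal_on_insert:
  assumes "orthonormal_on I e" "norm x = 1" "\<And>i. i \<in> I \<Longrightarrow> e i \<bullet> x = 0" "k \<notin> I"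
  shows "orthonormal_on (insert k I) (e(k := x))"
  using assms by (auto simp: orthonormal_on_def norm_eq_1 inner_commute)

lemma orthonormal_on_sum_inner:
  assumes "orthonormal_on I e" "finite I" "k \<in> I"
  shows "e k \<bullet> (\<Sum>i\<in>I. c i *\<^sub>R e i) = c k"
proof -
  have "e k \<bullet> (\<Sum>i\<in>I. c i *\<^sub>R e i) = (\<Sum>i\<in>I. if k = i then c i else 0)"
    unfolding inner_sum_right using assms by (intro sum.cong) (auto simp: orthonormal_on_def)
  then show ?thesis using assms by simp
qed

lemma orthonormal_on_norm_sum:
  assumes "orthonormal_on I e" "finite I"
  shows "(norm (\<Sum>i\<in>I. c i *\<^sub>R e i))\<^sup>2 = (\<Sum>i\<in>I. (c i)\<^sup>2)"
proof -
  have "(norm (\<Sum>i\<in>I. c i *\<^sub>R e i))\<^sup>2 = (\<Sum>i\<in>I. c i * (e i \<bullet> (\<Sum>i\<in>I. c i *\<^sub>R e i)))"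
    by (simp add: power2_norm_eq_inner inner_sum_left)
  also have "\<dots> = (\<Sum>i\<in>I. (c i)\<^sup>2)"
    using assms by (intro sum.cong) (simp_all add: orthonormal_on_sum_inner power2_eq_square)
  finally show ?thesis .
qed

text \<open>What remains of \<open>x\<close> after subtracting its components \<open>y\<close> along
  the family has a nonnegative squared norm.\<close>

lemma bessel_inequality:
  assumes "orthonormal_on I e" "finite I"
  shows "(\<Sum>i\<in>I. (e i \<bullet> x)\<^sup>2) \<le> (norm x)\<^sup>2"
proof -
  define y where "y = (\<Sum>i\<in>I. (e i \<bullet> x) *\<^sub>R e i)"
  have "y \<bullet> x = (\<Sum>i\<in>I. (e i \<bullet> x)\<^sup>2)"
    by (simp add: y_def inner_sum_left power2_eq_square)
  moreover have "(norm y)\<^sup>2 = (\<Sum>i\<in>I. (e i \<bullet> x)\<^sup>2)"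
    unfolding y_def by (rule orthonormal_on_norm_sum[OF assms])
  moreover have "0 \<le> (norm (x - y))\<^sup>2" by simp
  moreover have "(norm (x - y))\<^sup>2 = (norm x)\<^sup>2 - 2 * (y \<bullet> x) + (norm y)\<^sup>2"
    by (simp add: power2_norm_eq_inner inner_diff_left inner_diff_right inner_commute)
  ultimately show ?thesis by linarith
qed

text \<open>The residual \<open>y\<close> is orthogonal to the span of the family, which by the
  dimension count is the whole space, so \<open>y\<close> is orthogonal to itself.\<close>

lemma orthonormal_expansion:
  fixes e :: "'i::finite \<Rightarrow> 'a::euclidean_space"
  assumes e: "orthonormal_on UNIV e" and card: "CARD('i) = DIM('a)"
  shows "(\<Sum>i\<in>UNIV. (e i \<bullet> x) *\<^sub>R e i) = x"
proof -
  define y where "y = x - (\<Sum>i\<in>UNIV. (e i \<bullet> x) *\<^sub>R e i)"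
  have "e i \<bullet> y = 0" for i
    by (simp add: y_def inner_diff_right orthonormal_on_sum_inner[OF e])
  then have orth: "\<And>z. z \<in> range e \<Longrightarrow> orthogonal y z"
    by (auto simp: orthogonal_def inner_commute)
  have "card (range e) = DIM('a)"
    using card orthonormal_on_inj[OF e] by (simp add: card_image)
  then have "span (range e) = UNIV"
    using orthonormal_on_independent[OF e] by (metis dim_eq_full dim_eq_card_independent)
  then have "orthogonal y y" using orthogonal_to_span[of y "range e" y] orth by auto
  then show ?thesis by (simp add: y_def orthogonal_self)
qed

lemma ex_unit_orthogonal:
  fixes e :: "'i \<Rightarrow> 'a::euclidean_space"
  assumes "finite I" "card I < DIM('a)"
  shows "\<exists>x. norm x = 1 \<and> (\<forall>i\<in>I. e i \<bullet> x = 0)"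
proof -
  have "dim (e ` I) < DIM('a)"
    using assms by (meson card_image_le dim_le_card' finite_imageI le_trans not_le)
  then obtain x where x: "x \<noteq> 0" "\<And>y. y \<in> span (e ` I) \<Longrightarrow> orthogonal x y"
    using orthogonal_to_subspace_exists by blast
  then have "e i \<bullet> x = 0" if "i \<in> I" for i
    using that by (metis imageI inner_commute orthogonal_def span_base)
  with x(1) show ?thesis by (intro exI[of _ "x /\<^sub>R norm x"]) auto
qed

text \<open>Induction on the number of missing indices, adding one unit vector of the orthogonal
  complement each time. It later completes the right singular vectors to a basis.\<close>

lemma orthonormal_extend:
  fixes e :: "'i::finite \<Rightarrow> 'a::euclidean_space"
  assumes "orthonormal_on I e" "CARD('i) \<le> DIM('a)"
  shows "\<exists>e'. orthonormal_on UNIV e' \<and> (\<forall>i\<in>I. e' i = e i)"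
  using assms(1)
proof (induction "card (- I)" arbitrary: I e)
  case 0
  then have "I = UNIV" by auto
  with 0 show ?case by blast
next
  case (Suc c)
  then obtain k where k: "k \<notin> I" by (metis Compl_iff card.empty equals0I nat.distinct(1))
  then have "card I < DIM('a)"
    using assms(2) by (metis UNIV_I finite order_less_le_trans psubsetI psubset_card_mono subset_UNIV)
  then obtain x where x: "norm x = 1" "\<And>i. i \<in> I \<Longrightarrow> e i \<bullet> x = 0"
    using ex_unit_orthogonal[of I e] by auto
  have "c = card (- insert k I)"
    using Suc(2) k by (metis Compl_insert Compl_iff card_Diff_singleton diff_Suc_1)
  from Suc(1)[OF this orthonormal_on_insert[OF Suc(3) x k]]
  show ?case using k by (metis fun_upd_other insertCI)
qed

section \<open>Rank-one matrices and singular pairs\<close>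

definition outer :: "real^'m \<Rightarrow> real^'n \<Rightarrow> real^'n^'m" where
  "outer u v = (\<chi> i j. u $ i * v $ j)"

text \<open>This turns the bilinear form of \<open>A\<close> into a linear functional of
  \<open>A\<close>, so that bounds on it cut out half-spaces of matrices.\<close>

lemma inner_outer: "outer u v \<bullet> A = u \<bullet> (A *v v)"
  by (simp add: outer_def inner_vec_def matrix_vector_mult_def sum_distrib_left mult_ac)

lemma outer_mult_vec: "outer u v *v x = (v \<bullet> x) *\<^sub>R u"
  by (simp add: outer_def inner_vec_def matrix_vector_mult_def vec_eq_iff sum_distrib_left mult_ac)

lemma inner_outer_outer: "outer a b \<bullet> outer c d = (a \<bullet> c) * (b \<bullet> d)"
  by (simp add: inner_outer outer_mult_vec inner_commute)

lemma linear_outer_left: "linear (\<lambda>u. outer u v)"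
  by (rule linearI) (auto simp: outer_def vec_eq_iff algebra_simps)

lemma linear_outer_right: "linear (outer u)"
  by (rule linearI) (auto simp: outer_def vec_eq_iff algebra_simps)

lemma mult_vec_sum: "(\<Sum>i\<in>I. f i) *v x = (\<Sum>i\<in>I. f i *v x)"
  by (induction I rule: infinite_finite_induct) (auto simp: matrix_vector_mult_add_rdistrib)

lemma scaleR_mult_vec: "(c *\<^sub>R A) *v x = c *\<^sub>R (A *v x)" for A :: "real^'n^'m"
  by (simp add: scaleR_matrix_vector_assoc)

text \<open>A new pair of singular vectors is a maximiser of a \<bullet> (A b) over unit vectors orthogonal to the old pairs.\<close>

lemma singular_pairs_extend:
  fixes A :: "real^'n^'m"
  assumes u: "orthonormal_on I u" and v: "orthonormal_on I v"
    and fin: "finite I" and "card I < CARD('m)" and "card I < CARD('n)"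
    and Av: "\<And>i. i \<in> I \<Longrightarrow> A *v v i = s i *\<^sub>R u i" 
    and uA: "\<And>i. i \<in> I \<Longrightarrow> u i v* A = s i *\<^sub>R v i"
  obtains a b t where "norm a = 1" "norm b = 1" "0 \<le> t" "A *v b = t *\<^sub>R a" "a v* A = t *\<^sub>R b"
    "\<And>i. i \<in> I \<Longrightarrow> u i \<bullet> a = 0" "\<And>i. i \<in> I \<Longrightarrow> v i \<bullet> b = 0"
proof -
  define P where "P = {a. norm a = 1 \<and> (\<forall>i\<in>I. u i \<bullet> a = 0)}"
  define Q where "Q = {b. norm b = 1 \<and> (\<forall>i\<in>I. v i \<bullet> b = 0)}"
  have "P = sphere 0 1 \<inter> (\<Inter>i\<in>I. {a. u i \<bullet> a = 0})" by (auto simp: P_def)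
  then have "compact P" by (auto intro!: compact_Int_closed closed_INT closed_hyperplane)
  moreover have "Q = sphere 0 1 \<inter> (\<Inter>i\<in>I. {a. v i \<bullet> a = 0})" by (auto simp: Q_def)
  then have "compact Q" by (auto intro!: compact_Int_closed closed_INT closed_hyperplane)
  ultimately have cpt: "compact (P \<times> Q)" by (rule compact_Times)
  have "P \<noteq> {}" "Q \<noteq> {}"
    using ex_unit_orthogonal[of I u] ex_unit_orthogonal[of I v] assms by (auto simp: P_def Q_def)
  then have ne: "P \<times> Q \<noteq> {}" by auto
  have cont: "continuous_on (P \<times> Q) (\<lambda>p. fst p \<bullet> (A *v snd p))"
    by (intro continuous_on_inner continuous_on_fst continuous_on_id
        linear_continuous_on_compose[OF _ matrix_vector_mul_linear] continuous_on_snd)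
  obtain p where p: "p \<in> P \<times> Q" 
    and pmax: "\<And>q. q \<in> P \<times> Q \<Longrightarrow> fst q \<bullet> (A *v snd q) \<le> fst p \<bullet> (A *v snd p)"
    using continuous_attains_sup[OF cpt ne cont] by auto
  obtain a b where ab: "p = (a, b)" by fastforce
  define t where "t = a \<bullet> (A *v b)"
  have a: "a \<in> P" and b: "b \<in> Q" using p ab by auto
  have max: "a' \<bullet> (A *v b') \<le> t" if "a' \<in> P" "b' \<in> Q" for a' b'
    using pmax[of "(a', b')"] that by (auto simp: ab t_def)
  \<comment> \<open>Replacing \<open>a\<close> by its negative gives an admissible pair of value
    \<open>-t\<close>, hence \<open>-t\<close> is at most \<open>t\<close>.\<close>
  have "-a \<in> P" using a by (auto simp: P_def)
  from max[OF this b] have t0: "0 \<le> t" by (simp add: t_def)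
  \<comment> \<open>Equality case of Cauchy-Schwarz: a vector of norm at most \<open>t\<close> whose
    component along a unit vector \<open>z\<close> is \<open>t\<close> must be \<open>t\<close>
    times \<open>z\<close>.\<close>
  have unit: "x = t *\<^sub>R z" if "norm z = 1" "z \<bullet> x = t" "x = 0 \<or> (x /\<^sub>R norm x) \<bullet> x \<le> t"
    for x z :: "'b::real_inner"
  proof -
    have "norm x \<le> t" using that t0
      by (auto simp: power2_norm_eq_inner[symmetric] power2_eq_square divide_simps split: if_splits)
    then have nx: "(norm x)\<^sup>2 \<le> t\<^sup>2" by (simp add: power_mono)
    have "(norm (x - t *\<^sub>R z))\<^sup>2 = (norm x)\<^sup>2 - 2 * t * (z \<bullet> x) + t\<^sup>2 * (norm z)\<^sup>2"
      unfolding power2_norm_eq_inner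
      by (simp add: inner_diff_left inner_diff_right inner_commute power2_eq_square)
    also have "\<dots> \<le> 0" using nx that by (simp add: power2_eq_square)
    finally show ?thesis by simp
  qed
  have "A *v b = t *\<^sub>R a"
  proof (rule unit)
    show "norm a = 1" using a by (simp add: P_def)
    \<comment> \<open>The old left relations move \<open>A\<close> onto \<open>u i\<close>, giving a
      multiple of \<open>v i\<close>, which is orthogonal to \<open>b\<close>. So the normalised
      image of \<open>b\<close> is an admissible competitor for \<open>a\<close>.\<close>
    have "u i \<bullet> (A *v b) = 0" if "i \<in> I" for i
      using that b by (simp add: dot_lmul_matrix[symmetric] uA Q_def)
    then show "A *v b = 0 \<or> ((A *v b) /\<^sub>R norm (A *v b)) \<bullet> (A *v b) \<le> t"
      using max[OF _ b, of "(A *v b) /\<^sub>R norm (A *v b)"] by (cases "A *v b = 0") (auto simp: P_def)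
  qed (simp add: t_def)
  moreover have "a v* A = t *\<^sub>R b"
  proof (rule unit)
    show "norm b = 1" using b by (simp add: Q_def)
    show "b \<bullet> (a v* A) = t" by (simp add: t_def dot_lmul_matrix[symmetric] inner_commute)
    have "v i \<bullet> (a v* A) = 0" if "i \<in> I" for i
      using that a by (subst inner_commute) (simp add: dot_lmul_matrix Av P_def inner_commute[of a])
    then have "a v* A = 0 \<or> a \<bullet> (A *v ((a v* A) /\<^sub>R norm (a v* A))) \<le> t"
      using max[OF a, of "(a v* A) /\<^sub>R norm (a v* A)"] by (cases "a v* A = 0") (auto simp: Q_def)
    then show "a v* A = 0 \<or> ((a v* A) /\<^sub>R norm (a v* A)) \<bullet> (a v* A) \<le> t"
      by (metis dot_lmul_matrix inner_commute)
  qed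
  ultimately show ?thesis using that[of a b t] a b t0 by (auto simp: P_def Q_def)
qed

text \<open>Deflation: pairs are added one index at a time, and the assumption on the dimensions
  leaves room for a new vector on both sides.\<close>

lemma ex_singular_pairs:
  fixes A :: "real^'n^'m" and I :: "'m set"
  assumes "CARD('m) \<le> CARD('n)"
  shows "\<exists>u v s. orthonormal_on I u \<and> orthonormal_on I v \<and>
    (\<forall>i\<in>I. 0 \<le> s i \<and> A *v v i = s i *\<^sub>R u i \<and> u i v* A = s i *\<^sub>R v i)"
proof -
  have "finite I" by simp
  then show ?thesis
  proof (induction I rule: finite_induct)
    case empty
    show ?case by (simp add: orthonormal_on_def)
  next
    case (insert k I)
    then obtain u v s where uv: "orthonormal_on I u" "orthonormal_on I v"
      and s: "\<And>i. i \<in> I \<Longrightarrow> 0 \<le> s i" "\<And>i. i \<in> I \<Longrightarrow> A *v v i = s i *\<^sub>R u i"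
        "\<And>i. i \<in> I \<Longrightarrow> u i v* A = s i *\<^sub>R v i" by blast
    have card: "card I < CARD('m)" using insert(2)
      by (metis UNIV_I finite psubsetI psubset_card_mono subset_UNIV)
    then have card': "card I < CARD('n)" using assms by simp
    obtain a b t where abt: "norm a = 1" "norm b = 1" "0 \<le> t" "A *v b = t *\<^sub>R a" "a v* A = t *\<^sub>R b"
      "\<And>i. i \<in> I \<Longrightarrow> u i \<bullet> a = 0" "\<And>i. i \<in> I \<Longrightarrow> v i \<bullet> b = 0"
      using singular_pairs_extend[OF uv insert(1) card card' s(2,3)] by blast
    have "orthonormal_on (insert k I) (u(k := a))" "orthonormal_on (insert k I) (v(k := b))"
      using uv abt insert(2) by (auto intro!: orthonormal_on_insert simp del: fun_upd_apply)
    moreover have "\<forall>i\<in>insert k I. 0 \<le> (s(k := t)) i \<and>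
        A *v (v(k := b)) i = (s(k := t)) i *\<^sub>R (u(k := a)) i \<and>
        (u(k := a)) i v* A = (s(k := t)) i *\<^sub>R (v(k := b)) i"
      using insert(2) s abt by auto
    ultimately show ?case by blast
  qed
qed

text \<open>The \<open>u i\<close> form a basis, so \<open>A\<close> applied to \<open>x\<close> is
  determined by its coefficients along them, and the left relations give these as \<open>s i\<close>
  times the inner product of \<open>v i\<close> and \<open>x\<close>.\<close>

lemma singular_value_decomposition:
  fixes A :: "real^'n^'m"
  assumes "CARD('m) \<le> CARD('n)"
  obtains u :: "'m \<Rightarrow> real^'m" and v :: "'m \<Rightarrow> real^'n" and s
  where "orthonormal_on UNIV u" "orthonormal_on UNIV v" "\<And>i. 0 \<le> s i"
    "A = (\<Sum>i\<in>UNIV. s i *\<^sub>R outer (u i) (v i))"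
proof -
  obtain u :: "'m \<Rightarrow> real^'m" and v :: "'m \<Rightarrow> real^'n" and s
    where uv: "orthonormal_on UNIV u" "orthonormal_on UNIV v"
    and s: "\<And>i. 0 \<le> s i" "\<And>i. u i v* A = s i *\<^sub>R v i"
    using ex_singular_pairs[OF assms, of UNIV A] by blast
  have "A *v x = (\<Sum>i\<in>UNIV. s i *\<^sub>R outer (u i) (v i)) *v x" for x
  proof -
    have "A *v x = (\<Sum>i\<in>UNIV. (u i \<bullet> (A *v x)) *\<^sub>R u i)"
      by (rule orthonormal_expansion[OF uv(1), symmetric]) simp
    also have "\<dots> = (\<Sum>i\<in>UNIV. s i *\<^sub>R outer (u i) (v i)) *v x"
      by (simp add: mult_vec_sum scaleR_mult_vec outer_mult_vec dot_lmul_matrix[symmetric] s(2))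
    finally show ?thesis .
  qed
  then have "A = (\<Sum>i\<in>UNIV. s i *\<^sub>R outer (u i) (v i))" by (simp add: matrix_eq)
  with that uv s show ?thesis by blast
qed

subsection \<open>The spectral norm ball and soft thresholding\<close>

text \<open>The operator norm ball, phrased by the bilinear form so that it is visibly an
  intersection of closed half-spaces.\<close>

definition spectral_ball :: "real \<Rightarrow> (real^'n^'m) set" where
  "spectral_ball l = {X. \<forall>u v. norm u \<le> 1 \<longrightarrow> norm v \<le> 1 \<longrightarrow> u \<bullet> (X *v v) \<le> l}"

lemma spectral_ball_eq_INT:
  "spectral_ball l = (\<Inter>u\<in>cball 0 1. \<Inter>v\<in>cball 0 1. {X. outer u v \<bullet> X \<le> l})"
  by (auto simp: spectral_ball_def inner_outer)

lemma closed_spectral_ball: "closed (spectral_ball l)"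
  unfolding spectral_ball_eq_INT by (intro closed_INT ballI closed_halfspace_le)

lemma convex_spectral_ball: "convex (spectral_ball l)"
  unfolding spectral_ball_eq_INT by (intro convex_INT convex_halfspace_le)

lemma zero_in_spectral_ball: "0 \<le> l \<Longrightarrow> 0 \<in> spectral_ball l"
  by (simp add: spectral_ball_def)

text \<open>The bilinear form at \<open>a\<close>, \<open>b\<close> is a sum of products of
  coefficients; the termwise bound of a product by half the sum of squares reduces it to two Bessel
  inequalities.\<close>

lemma partial_isometry_in_spectral_ball:
  fixes u :: "'m::finite \<Rightarrow> real^'m" and v :: "'m \<Rightarrow> real^'n"
  assumes u: "orthonormal_on UNIV u" and v: "orthonormal_on UNIV v" and l: "0 \<le> l"
  shows "l *\<^sub>R (\<Sum>i\<in>UNIV. outer (u i) (v i)) \<in> spectral_ball l"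
proof -
  have "a \<bullet> ((l *\<^sub>R (\<Sum>i\<in>UNIV. outer (u i) (v i))) *v b) \<le> l" if "norm a \<le> 1" "norm b \<le> 1" for a b
  proof -
    have a1: "(\<Sum>i\<in>UNIV. (u i \<bullet> a)\<^sup>2) \<le> 1"
      using bessel_inequality[OF u, of a] that by (auto simp: power_le_one intro: order_trans)
    have b1: "(\<Sum>i\<in>UNIV. (v i \<bullet> b)\<^sup>2) \<le> 1"
      using bessel_inequality[OF v, of b] that by (auto simp: power_le_one intro: order_trans)
    have "(\<Sum>i\<in>UNIV. (u i \<bullet> a) * (v i \<bullet> b)) \<le> (\<Sum>i\<in>UNIV. ((u i \<bullet> a)\<^sup>2 + (v i \<bullet> b)\<^sup>2) / 2)"
    proof (rule sum_mono)
      fix i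
      have "0 \<le> (u i \<bullet> a - v i \<bullet> b)\<^sup>2" by simp
      then show "(u i \<bullet> a) * (v i \<bullet> b) \<le> ((u i \<bullet> a)\<^sup>2 + (v i \<bullet> b)\<^sup>2) / 2"
        unfolding power2_diff by simp
    qed
    also have "\<dots> = ((\<Sum>i\<in>UNIV. (u i \<bullet> a)\<^sup>2) + (\<Sum>i\<in>UNIV. (v i \<bullet> b)\<^sup>2)) / 2"
      by (simp add: sum.distrib flip: sum_divide_distrib)
    also have "\<dots> \<le> 1" using a1 b1 by simp
    finally have "l * (\<Sum>i\<in>UNIV. (u i \<bullet> a) * (v i \<bullet> b)) \<le> l * 1"
      using l by (intro mult_left_mono)
    then show ?thesis
      by (simp add: scaleR_mult_vec mult_vec_sum outer_mult_vec inner_sum_right inner_commute mult_ac)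
  qed
  then show ?thesis by (simp add: spectral_ball_def)
qed

text \<open>Half of the duality between spectral and nuclear norm; the other half is that the
  partial isometry built from the same singular vectors attains the bound.\<close>

lemma inner_spectral_ball_le:
  fixes u :: "'m::finite \<Rightarrow> real^'m" and v :: "'m \<Rightarrow> real^'n"
  assumes u: "orthonormal_on UNIV u" and v: "orthonormal_on UNIV v" and s: "\<And>i. 0 \<le> s i"
    and X: "X \<in> spectral_ball l"
  shows "(\<Sum>i\<in>UNIV. s i *\<^sub>R outer (u i) (v i)) \<bullet> X \<le> l * (\<Sum>i\<in>UNIV. s i)"
proof -
  have "s i * (u i \<bullet> (X *v v i)) \<le> s i * l" for i
    using X orthonormal_on_norm[OF u, of i] orthonormal_on_norm[OF v, of i] s
    by (intro mult_left_mono) (auto simp: spectral_ball_def)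
  then show ?thesis
    by (simp add: inner_sum_left inner_outer sum_distrib_left sum_mono mult.commute)
qed

lemma inner_partial_isometry:
  fixes u :: "'m::finite \<Rightarrow> real^'m" and v :: "'m \<Rightarrow> real^'n"
  assumes u: "orthonormal_on UNIV u" and v: "orthonormal_on UNIV v"
  shows "(\<Sum>i\<in>UNIV. s i *\<^sub>R outer (u i) (v i)) \<bullet> (l *\<^sub>R (\<Sum>i\<in>UNIV. outer (u i) (v i))) = l * (\<Sum>i\<in>UNIV. s i)"
proof -
  have "outer (u i) (v i) \<bullet> (\<Sum>j\<in>UNIV. outer (u j) (v j)) = 1" for i
  proof -
    have "outer (u i) (v i) \<bullet> (\<Sum>j\<in>UNIV. outer (u j) (v j)) = (\<Sum>j\<in>UNIV. if i = j then 1 else 0)"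
      unfolding inner_sum_right inner_outer_outer
      using u v by (intro sum.cong) (auto simp: orthonormal_on_def)
    then show ?thesis by simp
  qed
  then show ?thesis by (simp add: inner_sum_left sum_distrib_left)
qed

section \<open>Nuclear norm by duality and the closed form of the estimator\<close>

lemma svd_product_eq_sum_outer:
  fixes U :: "real^'m^'m" and V :: "real^'m^'n"
  shows "U ** diag_mat s ** transpose V = (\<Sum>i\<in>UNIV. s i *\<^sub>R outer (column i U) (column i V))"
proof -
  have "(U ** diag_mat s) $ a $ k = U $ a $ k * s k" for a k
    by (simp add: matrix_matrix_mult_def diag_mat_def if_distrib[of "\<lambda>x. _ * x"] cong: if_cong)
  then show ?thesis
    by (simp add: vec_eq_iff matrix_matrix_mult_def[of "U ** diag_mat s"] transpose_def outer_def
        column_def mult_ac)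
qed

lemma columns_orthonormal_iff:
  fixes V :: "real^'m^'n"
  shows "orthonormal_on UNIV (\<lambda>i. column i V) \<longleftrightarrow> transpose V ** V = mat 1"
  by (auto simp: orthonormal_on_def vec_eq_iff matrix_matrix_mult_def transpose_def mat_def
      column_def inner_vec_def)

lemma is_svd_iff_outer:
  "is_svd X U s V \<longleftrightarrow> orthonormal_on UNIV (\<lambda>i. column i U) \<and> orthonormal_on UNIV (\<lambda>i. column i V) \<and>
    (\<forall>i. 0 \<le> s i) \<and> X = (\<Sum>i\<in>UNIV. s i *\<^sub>R outer (column i U) (column i V))"
  by (simp add: is_svd_def columns_orthonormal_iff orthogonal_matrix svd_product_eq_sum_outer)

lemma is_svd_of_outer:
  assumes "orthonormal_on UNIV u" "orthonormal_on UNIV v" "\<And>i. 0 \<le> s i"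
  shows "is_svd (\<Sum>i\<in>UNIV. s i *\<^sub>R outer (u i) (v i)) (\<chi> a i. u i $ a) s (\<chi> b i. v i $ b)"
  using assms by (simp add: is_svd_iff_outer column_def vec_nth_inverse)

text \<open>The \<open>THE\<close> in the definition demands that all decompositions of
  \<open>X\<close> have the same sum of singular values. Pairing \<open>X\<close> with the partial
  isometry of one of them bounds its sum by that of any other.\<close>

lemma nuclear_norm_eqI:
  assumes "is_svd X U s V"
  shows "nuclear_norm X = (\<Sum>i\<in>UNIV. s i)"
proof -
  have le: "(\<Sum>i\<in>UNIV. s' i) \<le> (\<Sum>i\<in>UNIV. s i)" if svd: "is_svd X U s V" "is_svd X U' s' V'"
    for U s V U' s' V'
  proof -
    let ?W = "1 *\<^sub>R (\<Sum>i\<in>UNIV. outer (column i U') (column i V'))"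
    have "?W \<in> spectral_ball 1"
      by (rule partial_isometry_in_spectral_ball) (use svd(2) in \<open>auto simp: is_svd_iff_outer\<close>)
    then have "(\<Sum>i\<in>UNIV. s i *\<^sub>R outer (column i U) (column i V)) \<bullet> ?W \<le> 1 * (\<Sum>i\<in>UNIV. s i)"
      using svd(1) by (intro inner_spectral_ball_le) (auto simp: is_svd_iff_outer)
    moreover have "(\<Sum>i\<in>UNIV. s' i *\<^sub>R outer (column i U') (column i V')) \<bullet> ?W
        = 1 * (\<Sum>i\<in>UNIV. s' i)"
      using svd(2) by (intro inner_partial_isometry) (auto simp: is_svd_iff_outer)
    moreover have "(\<Sum>i\<in>UNIV. s i *\<^sub>R outer (column i U) (column i V)) = X"
      "(\<Sum>i\<in>UNIV. s' i *\<^sub>R outer (column i U') (column i V')) = X"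
      using svd by (simp_all add: is_svd_iff_outer)
    ultimately show ?thesis by simp
  qed
  show ?thesis unfolding nuclear_norm_def
    using assms le by (intro the_equality) (blast, blast intro: antisym)
qed

lemma nuclear_norm_support_function:
  fixes X :: "real^'n^'m"
  assumes "CARD('m) \<le> CARD('n)" "0 \<le> l"
  shows "W \<in> spectral_ball l \<Longrightarrow> X \<bullet> W \<le> l * nuclear_norm X"
    and "\<exists>W\<in>spectral_ball l. X \<bullet> W = l * nuclear_norm X"
proof -
  obtain u :: "'m \<Rightarrow> real^'m" and v :: "'m \<Rightarrow> real^'n" and s 
    where svd: "orthonormal_on UNIV u" "orthonormal_on UNIV v" "\<And>i. 0 \<le> s i"
      and X: "X = (\<Sum>i\<in>UNIV. s i *\<^sub>R outer (u i) (v i))"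
    using singular_value_decomposition[OF assms(1)] by blast
  have nuc: "nuclear_norm X = (\<Sum>i\<in>UNIV. s i)"
    unfolding X by (rule nuclear_norm_eqI[OF is_svd_of_outer[OF svd]])
  show "X \<bullet> W \<le> l * nuclear_norm X" if "W \<in> spectral_ball l"
    unfolding nuc unfolding X by (rule inner_spectral_ball_le[OF svd that])
  show "\<exists>W\<in>spectral_ball l. X \<bullet> W = l * nuclear_norm X"
    unfolding nuc unfolding X using inner_partial_isometry[OF svd(1,2), of s l] 
      partial_isometry_in_spectral_ball[OF svd(1,2) assms(2)] by blast
qed

text \<open>Moreau's decomposition: the residual \<open>X\<close> is the minimiser because the
  projection \<open>p\<close> maximises the inner product with \<open>X\<close> over the ball, i.e.
  \<open>p\<close> is a subgradient of \<open>l\<close> times the nuclear norm at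
  \<open>X\<close>.\<close>

lemma svst_eq:
  fixes Y :: "real^'n^'m"
  assumes "CARD('m) \<le> CARD('n)" "0 \<le> l"
  shows "svst l Y = Y - closest_point (spectral_ball l) Y"
proof -
  let ?N = "nuclear_norm :: real^'n^'m \<Rightarrow> real"
  define p where "p = closest_point (spectral_ball l) Y"
  define X where "X = Y - p"
  have p: "p \<in> spectral_ball l"
    unfolding p_def using closed_spectral_ball zero_in_spectral_ball[OF assms(2)]
    by (intro closest_point_in_set) auto
  \<comment> \<open>\<open>W\<close> attains the support function in direction \<open>X\<close>; the
    variational inequality of the projection, tested at \<open>W\<close>, shows that
    \<open>p\<close> attains it too.\<close>
  obtain W where W: "W \<in> spectral_ball l" "X \<bullet> W = l * ?N X"
    using nuclear_norm_support_function(2)[OF assms] by blast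
  have "X \<bullet> (W - p) \<le> 0"
    unfolding X_def p_def by (intro closest_point_dot convex_spectral_ball closed_spectral_ball W)
  then have NX: "l * ?N X \<le> X \<bullet> p" using W by (simp add: inner_diff_right)
  \<comment> \<open>The extra quadratic term expresses strong convexity and yields the uniqueness
    that \<open>THE\<close> requires.\<close>
  have low: "1/2 * (norm (Y - X))\<^sup>2 + l * ?N X + 1/2 * (norm (X' - X))\<^sup>2
      \<le> 1/2 * (norm (Y - X'))\<^sup>2 + l * ?N X'" for X'
  proof -
    have "X' \<bullet> p \<le> l * ?N X'" by (rule nuclear_norm_support_function(1)[OF assms p])
    moreover define D where "D = X' - X"
    have D: "Y - X' = p - D" "Y - X = p" "X' - X = D" by (simp_all add: D_def X_def)
    moreover have "X' \<bullet> p = X \<bullet> p + D \<bullet> p" by (simp add: D_def inner_diff_left)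
    moreover have "(norm (p - D))\<^sup>2 = (norm p)\<^sup>2 - 2 * (D \<bullet> p) + (norm D)\<^sup>2"
      by (simp add: power2_norm_eq_inner inner_diff_left inner_diff_right inner_commute[of p D])
    ultimately show ?thesis using NX unfolding D by linarith
  qed
  have "svst l Y = X" unfolding svst_def
  proof (rule the_equality)
    show "\<forall>X'. 1/2 * (norm (Y - X))\<^sup>2 + l * ?N X \<le> 1/2 * (norm (Y - X'))\<^sup>2 + l * ?N X'"
    proof
      fix X'
      have "0 \<le> (norm (X' - X))\<^sup>2" by simp
      with low[of X'] show "1/2 * (norm (Y - X))\<^sup>2 + l * ?N X \<le> 1/2 * (norm (Y - X'))\<^sup>2 + l * ?N X'"
        by linarith
    qed
    fix Z assume "\<forall>X'. 1/2 * (norm (Y - Z))\<^sup>2 + l * ?N Z \<le> 1/2 * (norm (Y - X'))\<^sup>2 + l * ?N X'"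
    then have "1/2 * (norm (Y - Z))\<^sup>2 + l * ?N Z \<le> 1/2 * (norm (Y - X))\<^sup>2 + l * ?N X" by blast
    with low[of Z] have "(norm (Z - X))\<^sup>2 \<le> 0" by linarith
    then show "Z = X" by simp
  qed
  then show ?thesis by (simp add: X_def p_def)
qed

subsection \<open>Rotation invariance of the Gaussian matrix\<close>

lemma nn_integral_lborel_translate:
  fixes f :: "'a::euclidean_space \<Rightarrow> ennreal"
  assumes "f \<in> borel_measurable borel"
  shows "(\<integral>\<^sup>+x. f (c + x) \<partial>lborel) = (\<integral>\<^sup>+x. f x \<partial>lborel)"
proof -
  have "(\<integral>\<^sup>+x. f x \<partial>lborel) = (\<integral>\<^sup>+x. f x \<partial>distr lborel borel ((+) c))"
    by (simp add: lborel_distr_plus)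
  also have "\<dots> = (\<integral>\<^sup>+x. f (c + x) \<partial>lborel)"
    using assms by (subst nn_integral_distr) auto
  finally show ?thesis by simp
qed

text \<open>Uniqueness of Haar measure by Fubini: after two translations, integrating
  1_A (T x) 1_B y over both variables gives vol A vol B, where B is the unit ball.\<close>

lemma lborel_distr_orthogonal:
  fixes T :: "'a::euclidean_space \<Rightarrow> 'a"
  assumes T: "orthogonal_transformation T"
  shows "distr lborel borel T = lborel"
proof (rule measure_eqI)
  fix A assume "A \<in> sets (distr lborel borel T)"
  then have A[measurable]: "A \<in> sets borel" by simp
  have lin: "linear T" using T by (rule orthogonal_transformation_linear)
  have T_meas[measurable]: "T \<in> borel_measurable borel"
    using lin by (intro borel_measurable_continuous_onI linear_continuous_on) (simp add: linear_conv_bounded_linear)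
  define S where "S = inv T"
  have TS: "T (S y) = y" for y
    unfolding S_def using orthogonal_transformation_surj[OF T] by (simp add: surj_f_inv_f)
  have normT: "norm (T x) = norm x" for x
    using T by (rule orthogonal_transformation_norm)
  define B :: "'a set" where "B = ball 0 1"
  have B[measurable]: "B \<in> sets borel" by (simp add: B_def)
  \<comment> \<open>As \<open>T\<close> is an isometry, the points \<open>x\<close> with
    \<open>y - T x\<close> in \<open>B\<close> form the unit ball around \<open>S y\<close>.\<close>
  have vol: "(\<integral>\<^sup>+x. indicator B (y - T x) \<partial>lborel) = emeasure lborel B" for y
  proof -
    have "indicator B (y - T x) = (indicator (ball (S y) 1) x :: ennreal)" for x
    proof -
      have "norm (y - T x) = norm (S y - x)" 
        using normT[of "S y - x"] by (simp add: linear_diff[OF lin] TS)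
      then show ?thesis by (simp add: B_def indicator_def dist_norm norm_minus_commute)
    qed
    then show ?thesis by (simp add: B_def emeasure_ball)
  qed
  have "emeasure (distr lborel borel T) A * emeasure lborel B
      = (\<integral>\<^sup>+y. (\<integral>\<^sup>+x. indicator A (T x) * indicator B y \<partial>lborel) \<partial>lborel)"
  proof -
    have "emeasure (distr lborel borel T) A = (\<integral>\<^sup>+x. indicator A x \<partial>distr lborel borel T)"
      by simp
    also have "\<dots> = (\<integral>\<^sup>+x. indicator A (T x) \<partial>lborel)"
      by (subst nn_integral_distr) auto
    finally show ?thesis by (simp add: nn_integral_multc nn_integral_cmult)
  qed
  also have "\<dots> = (\<integral>\<^sup>+y. (\<integral>\<^sup>+x. indicator A (T x + y) * indicator B y \<partial>lborel) \<partial>lborel)"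
  proof (rule nn_integral_cong)
    fix y
    show "(\<integral>\<^sup>+x. indicator A (T x) * indicator B y \<partial>lborel)
        = (\<integral>\<^sup>+x. indicator A (T x + y) * indicator B y \<partial>lborel)"
      by (subst nn_integral_lborel_translate[of _ "S y", symmetric])
        (simp_all add: linear_add[OF lin] TS add.commute)
  qed
  also have "\<dots> = (\<integral>\<^sup>+x. (\<integral>\<^sup>+y. indicator A (T x + y) * indicator B y \<partial>lborel) \<partial>lborel)"
    by (rule lborel_pair.Fubini') measurable
  also have "\<dots> = (\<integral>\<^sup>+x. (\<integral>\<^sup>+y. indicator A y * indicator B (y - T x) \<partial>lborel) \<partial>lborel)"
  proof (rule nn_integral_cong)
    fix x
    show "(\<integral>\<^sup>+y. indicator A (T x + y) * indicator B y \<partial>lborel)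
        = (\<integral>\<^sup>+y. indicator A y * indicator B (y - T x) \<partial>lborel)"
      by (subst nn_integral_lborel_translate[of "\<lambda>y. indicator A y * indicator B (y - T x)" "T x", symmetric])
        simp_all
  qed
  also have "\<dots> = (\<integral>\<^sup>+y. (\<integral>\<^sup>+x. indicator A y * indicator B (y - T x) \<partial>lborel) \<partial>lborel)"
    by (rule lborel_pair.Fubini') measurable
  also have "\<dots> = emeasure lborel A * emeasure lborel B"
    by (simp add: nn_integral_cmult vol nn_integral_multc)
  finally have "emeasure (distr lborel borel T) A * emeasure lborel B = emeasure lborel A * emeasure lborel B" .
  \<comment> \<open>The volume of \<open>B\<close> is positive and finite, so it can be
    cancelled.\<close>
  moreover have "unit_ball_vol (real DIM('a)) \<noteq> 0"
    by (rule not_sym, rule less_imp_neq, rule unit_ball_vol_pos) simp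
  then have "emeasure lborel B \<noteq> 0" "emeasure lborel B \<noteq> \<infinity>"
    unfolding B_def by (simp_all add: emeasure_ball)
  ultimately show "emeasure (distr lborel borel T) A = emeasure lborel A"
    by (simp add: ennreal_mult_cancel_left mult.commute[of _ "emeasure lborel B"])
qed simp

text \<open>The density depends on \<open>Z\<close> through its Frobenius norm only, which is the
  source of the invariance under all orthogonal maps of the matrix space.\<close>

lemma prod_std_normal_density:
  fixes Z :: "real^'n::finite^'m::finite"
  shows "(\<Prod>i\<in>UNIV. \<Prod>j\<in>UNIV. std_normal_density (Z $ i $ j))
    = (1 / sqrt (2 * pi)) ^ (CARD('n) * CARD('m)) * exp (- (norm Z)\<^sup>2 / 2)"
proof -
  have "(norm Z)\<^sup>2 = (\<Sum>i\<in>UNIV. \<Sum>j\<in>UNIV. (Z $ i $ j)\<^sup>2)"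
    unfolding power2_norm_eq_inner by (simp add: inner_vec_def power2_eq_square)
  then have "exp (- (norm Z)\<^sup>2 / 2) = (\<Prod>i\<in>UNIV. \<Prod>j\<in>UNIV. exp (- (Z $ i $ j)\<^sup>2 / 2))"
    by (simp add: exp_sum sum_divide_distrib flip: sum_negf)
  then show ?thesis
    by (simp only: std_normal_density_def prod.distrib prod_constant power_mult)
qed

lemma nn_integral_gauss_matrix_orthogonal:
  fixes f :: "real^'n::finite^'m::finite \<Rightarrow> ennreal" and T :: "real^'n^'m \<Rightarrow> real^'n^'m"
  assumes T: "orthogonal_transformation T" and f[measurable]: "f \<in> borel_measurable borel"
  shows "(\<integral>\<^sup>+Z. f (T Z) \<partial>gauss_matrix) = (\<integral>\<^sup>+Z. f Z \<partial>gauss_matrix)"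
proof -
  have T_meas[measurable]: "T \<in> borel_measurable borel"
    using orthogonal_transformation_linear[OF T]
    by (intro borel_measurable_continuous_onI linear_continuous_on) (simp add: linear_conv_bounded_linear)
  define \<phi> :: "real^'n^'m \<Rightarrow> ennreal" where
    "\<phi> Z = ennreal ((1 / sqrt (2 * pi)) ^ (CARD('n) * CARD('m)) * exp (- (norm Z)\<^sup>2 / 2))" for Z
  have [measurable]: "\<phi> \<in> borel_measurable borel" unfolding \<phi>_def by measurable
  have gauss: "(gauss_matrix :: (real^'n^'m) measure) = density lborel \<phi>"
    by (simp add: gauss_matrix_def prod_std_normal_density \<phi>_def[abs_def])
  have "(\<integral>\<^sup>+Z. f Z \<partial>gauss_matrix) = (\<integral>\<^sup>+Z. \<phi> Z * f Z \<partial>distr lborel borel T)"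
    unfolding gauss lborel_distr_orthogonal[OF T] by (simp add: nn_integral_density)
  also have "\<dots> = (\<integral>\<^sup>+Z. \<phi> (T Z) * f (T Z) \<partial>lborel)"
    by (simp add: nn_integral_distr)
  also have "\<dots> = (\<integral>\<^sup>+Z. f (T Z) \<partial>gauss_matrix)"
    unfolding gauss by (simp add: nn_integral_density \<phi>_def orthogonal_transformation_norm[OF T])
  finally show ?thesis by simp
qed

lemma sets_gauss_matrix [simp, measurable_cong]: "sets gauss_matrix = sets borel"
  by (simp add: gauss_matrix_def)

subsection \<open>Isometries between orthonormal bases of matrices\<close>

text \<open>The range is the span of those \<open>u i\<close> with \<open>s i\<close> nonzero: each
  such \<open>u i\<close> is the image of \<open>v i\<close> divided by \<open>s i\<close>.\<close>

lemma rank_singular_values: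
  fixes u :: "'m::finite \<Rightarrow> real^'m" and v :: "'m \<Rightarrow> real^'n"
  assumes u: "orthonormal_on UNIV u" and v: "orthonormal_on UNIV v"
  shows "rank (\<Sum>i\<in>UNIV. s i *\<^sub>R outer (u i) (v i)) = card {i. s i \<noteq> 0}"
proof -
  let ?A = "\<Sum>i\<in>UNIV. s i *\<^sub>R outer (u i) (v i)" and ?S = "{i. s i \<noteq> 0}"
  have Ax: "?A *v x = (\<Sum>i\<in>UNIV. (s i * (v i \<bullet> x)) *\<^sub>R u i)" for x
    by (simp add: mult_vec_sum scaleR_mult_vec outer_mult_vec)
  have uS: "orthonormal_on ?S u" using u by (simp add: orthonormal_on_def)
  have "range ((*v) ?A) = span (u ` ?S)"
  proof
    have "(s i * (v i \<bullet> x)) *\<^sub>R u i \<in> span (u ` ?S)" for i x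
      by (cases "s i = 0") (auto intro: span_mul span_base span_zero)
    then show "range ((*v) ?A) \<subseteq> span (u ` ?S)" by (auto simp: Ax intro!: span_sum)
    have "u i = ?A *v (v i /\<^sub>R s i)" if "s i \<noteq> 0" for i
    proof -
      have "?A *v (v i /\<^sub>R s i) = (\<Sum>j\<in>UNIV. if j = i then u i else 0)"
        unfolding Ax using that v by (intro sum.cong) (auto simp: orthonormal_on_def)
      then show ?thesis by simp
    qed
    then have "u ` ?S \<subseteq> range ((*v) ?A)" by blast
    moreover have "subspace (range ((*v) ?A))"
      by (intro linear_subspace_image matrix_vector_mul_linear subspace_UNIV)
    ultimately show "span (u ` ?S) \<subseteq> range ((*v) ?A)" by (rule span_minimal)
  qed
  then have "rank ?A = dim (u ` ?S)" by (simp add: rank_dim_range)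
  also have "\<dots> = card ?S"
    using orthonormal_on_independent[OF uS] orthonormal_on_inj[OF uS]
    by (simp add: dim_eq_card_independent card_image)
  finally show ?thesis .
qed

text \<open>An injection of \<open>S\<close> into \<open>D\<close> is completed by any bijection
  between the complements of \<open>S\<close> and of its image. This will align the supports of two
  lists of singular values.\<close>

lemma ex_bij_subset:
  fixes S D :: "'i::finite set"
  assumes "card S \<le> card D"
  shows "\<exists>\<pi>. bij \<pi> \<and> \<pi> ` S \<subseteq> D"
proof -
  obtain f where f: "f ` S \<subseteq> D" "inj_on f S"
    using card_le_inj[OF _ _ assms] by auto
  have "card (- S) = card (- f ` S)" using f by (simp add: Compl_eq_Diff_UNIV card_Diff_subset card_image)
  then obtain h where h: "bij_betw h (- S) (- f ` S)"
    using finite_same_card_bij[of "- S" "- f ` S"] by auto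
  let ?\<pi> = "\<lambda>i. if i \<in> S then f i else h i"
  have "bij_betw ?\<pi> S (f ` S)"
    using f(2) by (subst bij_betw_cong[of S ?\<pi> f]) (simp_all add: inj_on_imp_bij_betw)
  moreover have "bij_betw ?\<pi> (- S) (- f ` S)"
    using h by (subst bij_betw_cong[of "- S" ?\<pi> h]) simp_all
  ultimately have "bij_betw ?\<pi> (S \<union> - S) (f ` S \<union> - f ` S)"
    by (rule bij_betw_combine) simp
  then have "bij ?\<pi>" by simp
  moreover have "?\<pi> ` S \<subseteq> D" using f(1) by auto
  ultimately show ?thesis by blast
qed

text \<open>The change of basis from \<open>e\<close> to \<open>f\<close>, given by coefficients;
  swapping \<open>e\<close> and \<open>f\<close> gives the adjoint, and for orthonormal bases the
  inverse.\<close>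

definition onb_map :: "('k \<Rightarrow> 'a::real_inner) \<Rightarrow> ('k \<Rightarrow> 'b::real_inner) \<Rightarrow> 'a \<Rightarrow> 'b" where
  "onb_map e f x = (\<Sum>k\<in>UNIV. (e k \<bullet> x) *\<^sub>R f k)"

lemma linear_onb_map: "linear (onb_map e f)"
  by (rule linearI) (simp_all add: onb_map_def inner_add_right scaleR_left_distrib sum.distrib scaleR_sum_right)

lemma norm_onb_map:
  fixes e :: "'k::finite \<Rightarrow> 'a::euclidean_space" and f :: "'k \<Rightarrow> 'b::real_inner"
  assumes "orthonormal_on UNIV e" "orthonormal_on UNIV f" "CARD('k) = DIM('a)"
  shows "norm (onb_map e f x) = norm x"
proof -
  have "(norm (onb_map e f x))\<^sup>2 = (\<Sum>k\<in>UNIV. (e k \<bullet> x)\<^sup>2)"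
    unfolding onb_map_def by (rule orthonormal_on_norm_sum) (use assms in auto)
  also have "\<dots> = (norm (\<Sum>k\<in>UNIV. (e k \<bullet> x) *\<^sub>R e k))\<^sup>2"
    by (rule orthonormal_on_norm_sum[symmetric]) (use assms in auto)
  finally show ?thesis using orthonormal_expansion[OF assms(1,3), of x] by simp
qed

lemma orthogonal_transformation_onb_map:
  fixes e f :: "'k::finite \<Rightarrow> 'a::euclidean_space"
  assumes "orthonormal_on UNIV e" "orthonormal_on UNIV f" "CARD('k) = DIM('a)"
  shows "orthogonal_transformation (onb_map e f)"
  unfolding orthogonal_transformation using norm_onb_map[OF assms] linear_onb_map by blast

lemma onb_map_base:
  fixes e :: "'k::finite \<Rightarrow> 'a::real_inner" and f :: "'k \<Rightarrow> 'b::real_inner"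
  assumes "orthonormal_on UNIV e"
  shows "onb_map e f (e i) = f i"
proof -
  have "onb_map e f (e i) = (\<Sum>k\<in>UNIV. if k = i then f i else 0)"
    unfolding onb_map_def using assms by (intro sum.cong) (auto simp: orthonormal_on_def)
  then show ?thesis by simp
qed

lemma onb_map_inverse:
  fixes e :: "'k::finite \<Rightarrow> 'a::euclidean_space" and f :: "'k \<Rightarrow> 'b::real_inner"
  assumes "orthonormal_on UNIV e" "orthonormal_on UNIV f" "CARD('k) = DIM('a)"
  shows "onb_map f e (onb_map e f x) = x"
proof -
  have "onb_map f e (onb_map e f x) = (\<Sum>k\<in>UNIV. (e k \<bullet> x) *\<^sub>R onb_map f e (f k))"
    unfolding onb_map_def[of e f] by (simp add: linear_sum[OF linear_onb_map] linear_cmul[OF linear_onb_map])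
  also have "\<dots> = x"
    using orthonormal_expansion[OF assms(1,3)] by (simp add: onb_map_base[OF assms(2)])
  finally show ?thesis .
qed

definition outer_family :: "('i \<Rightarrow> real^'m) \<Rightarrow> ('j \<Rightarrow> real^'n) \<Rightarrow> 'i \<times> 'j \<Rightarrow> real^'n^'m" where
  "outer_family u w = (\<lambda>(i, j). outer (u i) (w j))"

lemma orthonormal_outer_family:
  assumes "orthonormal_on UNIV u" "orthonormal_on UNIV w"
  shows "orthonormal_on UNIV (outer_family u w)"
  using assms by (auto simp: orthonormal_on_def outer_family_def inner_outer_outer)

text \<open>Between product bases the change of basis is a tensor product: it acts on rows and
  columns separately, like multiplication by one matrix on each side.\<close>

lemma onb_map_outer:
  fixes u u' :: "'m::finite \<Rightarrow> real^'m" and w w' :: "'n::finite \<Rightarrow> real^'n"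
  shows "onb_map (outer_family u w) (outer_family u' w') (outer a b)
    = outer (onb_map u u' a) (onb_map w w' b)"
proof -
  have "outer (onb_map u u' a) (onb_map w w' b)
      = (\<Sum>i\<in>UNIV. \<Sum>j\<in>UNIV. ((u i \<bullet> a) * (w j \<bullet> b)) *\<^sub>R outer (u' i) (w' j))"
    unfolding onb_map_def
    by (simp only: linear_sum[OF linear_outer_left] linear_cmul[OF linear_outer_left])
      (simp add: linear_sum[OF linear_outer_right] linear_cmul[OF linear_outer_right] scaleR_sum_right)
  then show ?thesis
    unfolding onb_map_def[of "outer_family u w"]
    by (simp add: outer_family_def inner_outer_outer sum.cartesian_product split_def UNIV_Times_UNIV[symmetric] del: UNIV_Times_UNIV)
qed

lemma onb_map_spectral_ball:
  fixes u u' :: "'m::finite \<Rightarrow> real^'m" and w w' :: "'n::finite \<Rightarrow> real^'n"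
  assumes u: "orthonormal_on UNIV u" "orthonormal_on UNIV u'"
    and w: "orthonormal_on UNIV w" "orthonormal_on UNIV w'"
    and X: "X \<in> spectral_ball l"
  shows "onb_map (outer_family u w) (outer_family u' w') X \<in> spectral_ball l"
proof -
  have "a \<bullet> (onb_map (outer_family u w) (outer_family u' w') X *v b) \<le> l" if "norm a \<le> 1" "norm b \<le> 1" for a b
  proof -
    \<comment> \<open>The adjoint moves the map onto \<open>outer a b\<close>, which becomes an
      outer product of two vectors with the norms of \<open>a\<close> and \<open>b\<close>.\<close>
    have "a \<bullet> (onb_map (outer_family u w) (outer_family u' w') X *v b) 
        = onb_map (outer_family u' w') (outer_family u w) (outer a b) \<bullet> X"
      by (simp add: inner_outer[symmetric] onb_map_def inner_sum_left inner_sum_right inner_commute mult_ac)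
    also have "\<dots> = onb_map u' u a \<bullet> (X *v onb_map w' w b)"
      by (simp add: onb_map_outer inner_outer)
    also have "\<dots> \<le> l"
      using X that norm_onb_map[OF u(2,1)] norm_onb_map[OF w(2,1)] by (simp add: spectral_ball_def)
    finally show ?thesis .
  qed
  then show ?thesis by (simp add: spectral_ball_def)
qed

subsection \<open>Monotonicity and domination of the risk\<close>

lemma power2_norm_diff_inner:
  "(norm (x - y))\<^sup>2 = (norm x)\<^sup>2 - 2 * (x \<bullet> y) + (norm y)\<^sup>2" for x y :: "'a::real_inner"
  by (simp add: power2_norm_eq_inner inner_diff_left inner_diff_right inner_commute)

text \<open>Adding the variational inequalities of the projections \<open>p\<close> and
  \<open>q\<close> shows that \<open>C\<close> has a nonnegative inner product with
  \<open>q - p\<close>. Put back into the inequality at \<open>p\<close>, this makes the angle at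
  \<open>p\<close> between \<open>Z\<close> and \<open>q\<close> at least a right angle.\<close>

lemma norm_sub_closest_point_mono:
  fixes K :: "'a::euclidean_space set"
  assumes K: "convex K" "closed K" "K \<noteq> {}" and \<mu>: "0 \<le> \<mu>" "\<mu> \<le> \<nu>"
  shows "norm (Z - closest_point K (\<mu> *\<^sub>R C + Z)) \<le> norm (Z - closest_point K (\<nu> *\<^sub>R C + Z))"
proof (cases "\<mu> = \<nu>")
  case False
  with \<mu> have less: "0 < \<nu> - \<mu>" by simp
  define p where "p = closest_point K (\<mu> *\<^sub>R C + Z)"
  define q where "q = closest_point K (\<nu> *\<^sub>R C + Z)"
  have "p \<in> K" "q \<in> K" using K by (auto simp: p_def q_def closest_point_in_set)
  then have pq: "(\<mu> *\<^sub>R C + Z - p) \<bullet> (q - p) \<le> 0" and qp: "(\<nu> *\<^sub>R C + Z - q) \<bullet> (p - q) \<le> 0"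
    unfolding p_def q_def using K by (auto intro!: closest_point_dot)
  have "(\<mu> *\<^sub>R C + Z - p) \<bullet> (q - p) + (\<nu> *\<^sub>R C + Z - q) \<bullet> (p - q)
      = (q - p) \<bullet> (q - p) - (\<nu> - \<mu>) * (C \<bullet> (q - p))"
    by (simp add: inner_diff_left inner_diff_right inner_add_left inner_commute algebra_simps)
  moreover have "0 \<le> (q - p) \<bullet> (q - p)" by simp
  ultimately have "0 \<le> (\<nu> - \<mu>) * (C \<bullet> (q - p))" using pq qp by linarith
  then have "0 \<le> C \<bullet> (q - p)" using less by (simp add: zero_le_mult_iff)
  then have "0 \<le> \<mu> * (C \<bullet> (q - p))" using \<mu> by simp
  moreover have "(\<mu> *\<^sub>R C + Z - p) \<bullet> (q - p) = \<mu> * (C \<bullet> (q - p)) + (Z - p) \<bullet> (q - p)"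
    by (simp add: inner_diff_left inner_add_left algebra_simps)
  ultimately have "(Z - p) \<bullet> (q - p) \<le> 0" using pq by linarith
  moreover have "(norm (Z - q))\<^sup>2 = (norm (Z - p))\<^sup>2 - 2 * ((Z - p) \<bullet> (q - p)) + (norm (q - p))\<^sup>2"
    using power2_norm_diff_inner[of "Z - p" "q - p"] by simp
  moreover have "0 \<le> (norm (q - p))\<^sup>2" by simp
  ultimately have "(norm (Z - p))\<^sup>2 \<le> (norm (Z - q))\<^sup>2" by linarith
  then show ?thesis by (simp add: p_def q_def power_mono_iff)
qed simp

text \<open>A quantitative form of the convergence to the face exposed by C, which avoids compactness.
  The matrix l (\<Sum>i. outer (a i) (b i)) lies in the faces exposed by both C and X.\<close>

lemma norm_sub_closest_point_spectral_ball_bound: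
  fixes a :: "'m::finite \<Rightarrow> real^'m" and b :: "'m \<Rightarrow> real^'n" and Z :: "real^'n^'m"
  assumes a: "orthonormal_on UNIV a" and b: "orthonormal_on UNIV b"
    and s: "\<And>i. 0 \<le> s i" "\<And>i. s i \<le> c * d i" and d: "\<And>i. 0 \<le> d i"
    and c: "0 \<le> c" and l: "0 \<le> l" and k: "0 < k"
    and X: "X = (\<Sum>i\<in>UNIV. s i *\<^sub>R outer (a i) (b i))"
    and C: "C = (\<Sum>i\<in>UNIV. d i *\<^sub>R outer (a i) (b i))"
  shows "(norm (Z - closest_point (spectral_ball l) (X + Z)))\<^sup>2
      - c * (norm (Z - l *\<^sub>R (\<Sum>i\<in>UNIV. outer (a i) (b i))))\<^sup>2 / (2 * k)
    \<le> (norm (Z - closest_point (spectral_ball l) (k *\<^sub>R C + Z)))\<^sup>2"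
proof -
  let ?K = "spectral_ball l :: (real^'n^'m) set"
  define W where "W = l *\<^sub>R (\<Sum>i\<in>UNIV. outer (a i) (b i))"
  define p where "p = closest_point ?K (X + Z)"
  define q where "q = closest_point ?K (k *\<^sub>R C + Z)"
  have W: "W \<in> ?K" unfolding W_def by (rule partial_isometry_in_spectral_ball[OF a b l])
  then have ne: "?K \<noteq> {}" by auto
  have p: "p \<in> ?K" and q: "q \<in> ?K"
    unfolding p_def q_def using closest_point_in_set[OF closed_spectral_ball ne] by auto
  have pq: "(X + Z - p) \<bullet> (q - p) \<le> 0"
    unfolding p_def by (rule closest_point_dot[OF convex_spectral_ball closed_spectral_ball q])
  have qW: "(k *\<^sub>R C + Z - q) \<bullet> (W - q) \<le> 0"
    unfolding q_def by (rule closest_point_dot[OF convex_spectral_ball closed_spectral_ball W])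
  have XW: "X \<bullet> W = l * (\<Sum>i\<in>UNIV. s i)" and CW: "C \<bullet> W = l * (\<Sum>i\<in>UNIV. d i)"
    unfolding X C W_def by (simp_all only: inner_partial_isometry[OF a b])
  have Xp: "X \<bullet> p \<le> X \<bullet> W" unfolding XW unfolding X by (rule inner_spectral_ball_le[OF a b s(1) p])
  \<comment> \<open>Polarisation: four times the inner product of two vectors is at most the squared
    norm of their sum, here \<open>Z - W\<close>, a bound free of \<open>q\<close>.\<close>
  have "0 \<le> (norm ((Z - q) - (q - W)))\<^sup>2" by simp
  moreover have "(norm (Z - W))\<^sup>2 = (norm (Z - q))\<^sup>2 + 2 * ((Z - q) \<bullet> (q - W)) + (norm (q - W))\<^sup>2"
    using power2_norm_diff_inner[of "Z - q" "- (q - W)"] by (simp add: norm_minus_commute inner_diff_right)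
  ultimately have M: "(Z - q) \<bullet> (q - W) \<le> (norm (Z - W))\<^sup>2 / 4"
    using power2_norm_diff_inner[of "Z - q" "q - W"] by linarith
  have "(k *\<^sub>R C + Z - q) \<bullet> (W - q) = k * (C \<bullet> (W - q)) - (Z - q) \<bullet> (q - W)"
    by (simp add: inner_diff_left inner_diff_right inner_add_left algebra_simps)
  with qW M have "k * (C \<bullet> (W - q)) \<le> (norm (Z - W))\<^sup>2 / 4" by linarith
  \<comment> \<open>\<open>W\<close> maximises the inner product with \<open>C\<close> over the
    ball, so \<open>q\<close> misses the face exposed by \<open>C\<close> by a gap of order
    \<open>1 / k\<close>.\<close>
  then have "C \<bullet> (W - q) \<le> (norm (Z - W))\<^sup>2 / 4 / k"
    by (subst pos_le_divide_eq[OF k]) (simp only: mult.commute)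
  then have "c * (C \<bullet> (W - q)) \<le> c * ((norm (Z - W))\<^sup>2 / 4 / k)"
    using c by (rule mult_left_mono)
  moreover have "X \<bullet> (W - q) \<le> c * (C \<bullet> (W - q))"
  proof -
    \<comment> \<open>Each singular pair contributes a nonnegative gap, so
      \<open>s i \<le> c * d i\<close> compares the gap for \<open>X\<close> with \<open>c\<close>
      times that for \<open>C\<close> term by term.\<close>
    have "a i \<bullet> (q *v b i) \<le> l" for i
      using q orthonormal_on_norm[OF a, of i] orthonormal_on_norm[OF b, of i] 
      by (auto simp: spectral_ball_def)
    then have "s i * (l - a i \<bullet> (q *v b i)) \<le> (c * d i) * (l - a i \<bullet> (q *v b i))" for i
      using s(2)[of i] by (intro mult_right_mono) auto
    then have "(\<Sum>i\<in>UNIV. s i * (l - a i \<bullet> (q *v b i))) \<le> (\<Sum>i\<in>UNIV. (c * d i) * (l - a i \<bullet> (q *v b i)))"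
      by (rule sum_mono)
    moreover have "X \<bullet> (W - q) = (\<Sum>i\<in>UNIV. s i * (l - a i \<bullet> (q *v b i)))"
      unfolding inner_diff_right XW unfolding X
      by (simp add: inner_sum_left inner_outer sum_distrib_left sum_subtractf right_diff_distrib mult.commute)
    moreover have "C \<bullet> (W - q) = (\<Sum>i\<in>UNIV. d i * (l - a i \<bullet> (q *v b i)))"
      unfolding inner_diff_right CW unfolding C
      by (simp add: inner_sum_left inner_outer sum_distrib_left sum_subtractf right_diff_distrib mult.commute)
    ultimately show ?thesis by (simp add: sum_distrib_left mult.assoc)
  qed
  moreover have "(X + Z - p) \<bullet> (q - p) = X \<bullet> (W - p) - X \<bullet> (W - q) + (Z - p) \<bullet> (q - p)"
    by (simp add: inner_diff_left inner_diff_right inner_add_left)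
  moreover have "0 \<le> X \<bullet> (W - p)" using Xp by (simp add: inner_diff_right)
  ultimately have zpq: "(Z - p) \<bullet> (q - p) \<le> c * ((norm (Z - W))\<^sup>2 / 4 / k)"
    using pq by linarith
  have "(norm (Z - q))\<^sup>2 = (norm (Z - p))\<^sup>2 - 2 * ((Z - p) \<bullet> (q - p)) + (norm (q - p))\<^sup>2"
    using power2_norm_diff_inner[of "Z - p" "q - p"] by simp
  moreover have "0 \<le> (norm (q - p))\<^sup>2" by simp
  ultimately have "(norm (Z - p))\<^sup>2 - 2 * (c * ((norm (Z - W))\<^sup>2 / 4 / k)) \<le> (norm (Z - q))\<^sup>2"
    using zpq by linarith
  then show ?thesis by (simp add: p_def q_def W_def)
qed

section \<open>From pointwise losses to the risk\<close>

definition spectral_loss :: "real \<Rightarrow> real^'n::finite^'m::finite \<Rightarrow> real^'n^'m \<Rightarrow> ennreal" where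
  "spectral_loss l X Z = ennreal ((norm (Z - closest_point (spectral_ball l) (X + Z)))\<^sup>2)"

lemma borel_measurable_spectral_loss:
  fixes X :: "real^'n::finite^'m::finite"
  assumes "0 \<le> l"
  shows "(\<lambda>Z. spectral_loss l X (t *\<^sub>R Z)) \<in> borel_measurable borel"
proof -
  have "spectral_ball l \<noteq> ({} :: (real^'n^'m) set)" using zero_in_spectral_ball[OF assms] by auto
  then have "continuous_on UNIV (closest_point (spectral_ball l :: (real^'n^'m) set))"
    by (intro continuous_on_closest_point convex_spectral_ball closed_spectral_ball)
  then have [measurable]: "closest_point (spectral_ball l :: (real^'n^'m) set) \<in> borel_measurable borel"
    by (rule borel_measurable_continuous_onI)
  show ?thesis unfolding spectral_loss_def by measurable
qed

lemma risk_svst: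
  fixes X :: "real^'n::finite^'m::finite"
  assumes "CARD('m) \<le> CARD('n)" "0 \<le> l"
  shows "risk (svst l) X = ennreal (1 / real CARD('m)) *
    (\<integral>\<^sup>+Z. spectral_loss l X ((1 / sqrt (real CARD('n))) *\<^sub>R Z) \<partial>gauss_matrix)"
proof -
  have "svst l (X + A) - X = A - closest_point (spectral_ball l) (X + A)" for A
    by (simp add: svst_eq[OF assms])
  then show ?thesis by (simp only: risk_def spectral_loss_def)
qed

lemma risk_svst_mono:
  fixes C :: "real^'n::finite^'m::finite"
  assumes "CARD('m) \<le> CARD('n)" "0 \<le> l" "0 \<le> \<mu>" "\<mu> \<le> \<nu>"
  shows "risk (svst l) (\<mu> *\<^sub>R C) \<le> risk (svst l) (\<nu> *\<^sub>R C)"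
proof -
  have "spectral_loss l (\<mu> *\<^sub>R C) Z \<le> spectral_loss l (\<nu> *\<^sub>R C) Z" for Z
    unfolding spectral_loss_def using zero_in_spectral_ball[OF assms(2)] assms(3,4)
    by (intro ennreal_leI power_mono norm_sub_closest_point_mono convex_spectral_ball closed_spectral_ball) auto
  then show ?thesis
    unfolding risk_svst[OF assms(1,2)] by (intro mult_left_mono nn_integral_mono) auto
qed

text \<open>\<open>T\<close> and its inverse \<open>S\<close> are isometries preserving the ball, so
  projection commutes with \<open>T\<close>. The loss at \<open>T X\<close> with noise
  \<open>T Z\<close> is then the loss at \<open>X\<close> with noise \<open>Z\<close>, and
  \<open>T Z\<close> integrates like \<open>Z\<close>.\<close>

lemma risk_svst_rotation:
  fixes u u' :: "'m::finite \<Rightarrow> real^'m" and w w' :: "'n::finite \<Rightarrow> real^'n"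
  assumes card: "CARD('m) \<le> CARD('n)" "0 \<le> l"
    and u: "orthonormal_on UNIV u" "orthonormal_on UNIV u'"
    and w: "orthonormal_on UNIV w" "orthonormal_on UNIV w'"
  shows "risk (svst l) (onb_map (outer_family u w) (outer_family u' w') X) = risk (svst l) X"
proof -
  let ?K = "spectral_ball l :: (real^'n^'m) set"
  define T where "T = onb_map (outer_family u w) (outer_family u' w')"
  define S where "S = onb_map (outer_family u' w') (outer_family u w)"
  note onb = orthonormal_outer_family[OF u(1) w(1)] orthonormal_outer_family[OF u(2) w(2)]
  have dim: "CARD('m \<times> 'n) = DIM(real^'n^'m)" by simp
  have T: "orthogonal_transformation T"
    unfolding T_def by (rule orthogonal_transformation_onb_map[OF onb dim])
  have lin: "linear T" unfolding T_def by (rule linear_onb_map)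
  have TS: "T (S Y) = Y" for Y unfolding T_def S_def by (rule onb_map_inverse[OF onb(2,1) dim])
  have normT: "norm (T Y) = norm Y" for Y by (rule orthogonal_transformation_norm[OF T])
  have TK: "T Y \<in> ?K" if "Y \<in> ?K" for Y
    unfolding T_def by (rule onb_map_spectral_ball[OF u w that])
  have SK: "S Y \<in> ?K" if "Y \<in> ?K" for Y
    unfolding S_def by (rule onb_map_spectral_ball[OF u(2,1) w(2,1) that])
  have ne: "?K \<noteq> {}" using zero_in_spectral_ball[OF card(2)] by auto
  have cp: "closest_point ?K (T Y) = T (closest_point ?K Y)" for Y
  proof (rule closest_point_unique[OF convex_spectral_ball closed_spectral_ball, symmetric])
    show "T (closest_point ?K Y) \<in> ?K" by (intro TK closest_point_in_set closed_spectral_ball ne)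
    show "\<forall>z\<in>?K. dist (T Y) (T (closest_point ?K Y)) \<le> dist (T Y) z"
    proof
      fix z assume "z \<in> ?K"
      then have "dist Y (closest_point ?K Y) \<le> dist Y (S z)"
        by (intro closest_point_le closed_spectral_ball SK)
      moreover have "dist (T Y) (T V) = dist Y V" for V
        using normT[of "Y - V"] by (simp add: dist_norm linear_diff[OF lin])
      ultimately show "dist (T Y) (T (closest_point ?K Y)) \<le> dist (T Y) z"
        by (metis TS)
    qed
  qed
  have loss: "spectral_loss l (T X) (t *\<^sub>R T Z) = spectral_loss l X (t *\<^sub>R Z)" for Z t
  proof -
    have "t *\<^sub>R T Z - closest_point ?K (T X + t *\<^sub>R T Z) = T (t *\<^sub>R Z - closest_point ?K (X + t *\<^sub>R Z))"
      by (simp add: linear_diff[OF lin] linear_cmul[OF lin] linear_add[OF lin] flip: cp)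
    then show ?thesis by (simp add: spectral_loss_def normT)
  qed
  define t where "t = 1 / sqrt (real CARD('n))"
  have "(\<integral>\<^sup>+Z. spectral_loss l (T X) (t *\<^sub>R Z) \<partial>gauss_matrix)
      = (\<integral>\<^sup>+Z. spectral_loss l (T X) (t *\<^sub>R T Z) \<partial>gauss_matrix)"
    by (rule nn_integral_gauss_matrix_orthogonal[OF T borel_measurable_spectral_loss[OF card(2)], symmetric])
  then show ?thesis
    unfolding risk_svst[OF card] T_def[symmetric] by (simp add: loss t_def)
qed

lemma risk_svst_le_SUP_ray:
  fixes a :: "'m::finite \<Rightarrow> real^'m" and b :: "'m \<Rightarrow> real^'n::finite"
  assumes card: "CARD('m) \<le> CARD('n)" "0 \<le> l"
    and a: "orthonormal_on UNIV a" and b: "orthonormal_on UNIV b"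
    and s: "\<And>i. 0 \<le> s i" and d: "\<And>i. 0 \<le> d i" and sd: "\<And>i. s i \<noteq> 0 \<Longrightarrow> d i \<noteq> 0"
    and X: "X = (\<Sum>i\<in>UNIV. s i *\<^sub>R outer (a i) (b i))"
    and C: "C = (\<Sum>i\<in>UNIV. d i *\<^sub>R outer (a i) (b i))"
  shows "risk (svst l) X \<le> (SUP k::nat. risk (svst l) (real k *\<^sub>R C))"
proof -
  \<comment> \<open>The sum of the ratios dominates each of them; where \<open>d i\<close> is zero,
    division yields zero and \<open>s i\<close> vanishes as well.\<close>
  define c where "c = (\<Sum>i\<in>UNIV. s i / d i)"
  have c0: "0 \<le> c" unfolding c_def using s d by (intro sum_nonneg) simp
  have sc: "s i \<le> c * d i" for i
  proof (cases "d i = 0")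
    case False
    have "s i / d i \<le> c" unfolding c_def using s d by (intro member_le_sum) auto
    with False d[of i] show ?thesis by (simp add: pos_divide_le_eq)
  next
    case True
    with sd[of i] have "s i = 0" by blast
    with True show ?thesis by simp
  qed
  define W where "W = l *\<^sub>R (\<Sum>i\<in>UNIV. outer (a i) (b i))"
  have loss: "spectral_loss l X Z \<le> (SUP k::nat. spectral_loss l (real k *\<^sub>R C) Z)" for Z
  proof (rule LIMSEQ_le_const2)
    let ?x = "(norm (Z - closest_point (spectral_ball l) (X + Z)))\<^sup>2"
    \<comment> \<open>The index is \<open>Suc k\<close> because the bound is stated for positive
      multiples of \<open>C\<close>; its error term tends to zero.\<close>
    have "(\<lambda>k. ?x - c * (norm (Z - W))\<^sup>2 / 2 * inverse (real (Suc k)))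
        \<longlonglongrightarrow> ?x - c * (norm (Z - W))\<^sup>2 / 2 * 0"
      by (intro tendsto_intros LIMSEQ_inverse_real_of_nat)
    then show "(\<lambda>k. ennreal (?x - c * (norm (Z - W))\<^sup>2 / 2 * inverse (real (Suc k))))
        \<longlonglongrightarrow> spectral_loss l X Z"
      unfolding spectral_loss_def by (intro tendsto_ennrealI) simp
    have rearrange: "y / 2 * inverse (real (Suc k)) = y / (2 * real (Suc k))" for y k
      by (simp only: divide_inverse inverse_mult_distrib mult.assoc)
    have "ennreal (?x - c * (norm (Z - W))\<^sup>2 / 2 * inverse (real (Suc k)))
        \<le> (SUP k::nat. spectral_loss l (real k *\<^sub>R C) Z)" for k
    proof (rule SUP_upper2[of "Suc k"])
      show "ennreal (?x - c * (norm (Z - W))\<^sup>2 / 2 * inverse (real (Suc k)))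
          \<le> spectral_loss l (real (Suc k) *\<^sub>R C) Z"
        unfolding spectral_loss_def W_def rearrange
        by (intro ennreal_leI norm_sub_closest_point_spectral_ball_bound[OF a b s sc d c0 card(2) _ X C]) simp
    qed simp
    then show "\<exists>N. \<forall>k\<ge>N. ennreal (?x - c * (norm (Z - W))\<^sup>2 / 2 * inverse (real (Suc k)))
        \<le> (SUP k::nat. spectral_loss l (real k *\<^sub>R C) Z)" by blast
  qed
  define t where "t = 1 / sqrt (real CARD('n))"
  \<comment> \<open>Losses grow along the ray, so monotone convergence exchanges the supremum with
    the integral.\<close>
  have inc: "incseq (\<lambda>(k::nat) Z. spectral_loss l (real k *\<^sub>R C) (t *\<^sub>R Z))"
    unfolding spectral_loss_def using zero_in_spectral_ball[OF card(2)]
    by (intro monoI le_funI ennreal_leI power_mono norm_sub_closest_point_mono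
        convex_spectral_ball closed_spectral_ball) auto
  have "risk (svst l) X \<le> ennreal (1 / real CARD('m)) *
      (\<integral>\<^sup>+Z. (SUP k::nat. spectral_loss l (real k *\<^sub>R C) (t *\<^sub>R Z)) \<partial>gauss_matrix)"
    unfolding risk_svst[OF card] t_def by (intro mult_left_mono nn_integral_mono loss) simp
  also have "\<dots> = (SUP k::nat. risk (svst l) (real k *\<^sub>R C))"
    unfolding risk_svst[OF card] t_def[symmetric]
    using inc borel_measurable_spectral_loss[OF card(2)]
    by (subst nn_integral_monotone_convergence_SUP)
      (simp_all add: SUP_mult_left_ennreal measurable_cong_sets[OF sets_gauss_matrix refl])
  finally show ?thesis .
qed

text \<open>A permutation of the singular pairs of \<open>C\<close> makes their support cover that
  of \<open>X\<close>, and a rotation carries the singular vectors of \<open>X\<close> to the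
  permuted ones of \<open>C\<close>.\<close>

lemma risk_svst_le_SUP_ray_rank:
  fixes X C :: "real^'n::finite^'m::finite"
  assumes card: "CARD('m) \<le> CARD('n)" "0 \<le> l" and rank: "rank X \<le> rank C"
  shows "risk (svst l) X \<le> (SUP k::nat. risk (svst l) (real k *\<^sub>R C))"
proof -
  obtain u' :: "'m \<Rightarrow> real^'m" and v' :: "'m \<Rightarrow> real^'n" and s
    where u': "orthonormal_on UNIV u'" and v': "orthonormal_on UNIV v'" and s: "\<And>i. 0 \<le> s i"
      and X: "X = (\<Sum>i\<in>UNIV. s i *\<^sub>R outer (u' i) (v' i))"
    using singular_value_decomposition[OF card(1)] by blast
  obtain u :: "'m \<Rightarrow> real^'m" and v :: "'m \<Rightarrow> real^'n" and d
    where u: "orthonormal_on UNIV u" and v: "orthonormal_on UNIV v" and d: "\<And>i. 0 \<le> d i"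
      and C: "C = (\<Sum>i\<in>UNIV. d i *\<^sub>R outer (u i) (v i))"
    using singular_value_decomposition[OF card(1)] by blast
  have "card {i. s i \<noteq> 0} \<le> card {i. d i \<noteq> 0}"
    using rank unfolding X C rank_singular_values[OF u' v'] rank_singular_values[OF u v] .
  then obtain \<pi> :: "'m \<Rightarrow> 'm" where \<pi>: "bij \<pi>" "\<pi> ` {i. s i \<noteq> 0} \<subseteq> {i. d i \<noteq> 0}"
    using ex_bij_subset by blast
  have inj: "\<pi> i = \<pi> j \<longleftrightarrow> i = j" for i j using \<pi>(1) by (meson bij_is_inj injD)
  define a where "a = (\<lambda>i. u (\<pi> i))"
  define b where "b = (\<lambda>i. v (\<pi> i))"
  have a: "orthonormal_on UNIV a" and b: "orthonormal_on UNIV b"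
    using u v by (simp_all add: orthonormal_on_def a_def b_def inj)
  have C': "C = (\<Sum>i\<in>UNIV. d (\<pi> i) *\<^sub>R outer (a i) (b i))"
    unfolding C a_def b_def by (rule sum.reindex_bij_betw[OF \<pi>(1), symmetric])
  \<comment> \<open>The right singular vectors are indexed by \<open>'m\<close>, a basis of the row
    space by \<open>'n\<close>; \<open>\<iota>\<close> gives them their places in it before they are
    completed.\<close>
  obtain \<iota> :: "'m \<Rightarrow> 'n" where \<iota>: "inj \<iota>"
    using card_le_inj[of "UNIV :: 'm set" "UNIV :: 'n set"] card(1) by auto
  have ext: "\<exists>w. orthonormal_on UNIV w \<and> (\<forall>i. w (\<iota> i) = x i)"
    if x: "orthonormal_on UNIV x" for x :: "'m \<Rightarrow> real^'n"
  proof -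
    have "orthonormal_on (range \<iota>) (\<lambda>j. x (inv \<iota> j))"
      using x \<iota> by (auto simp: orthonormal_on_def inj_eq)
    from orthonormal_extend[OF this] show ?thesis using \<iota> by auto
  qed
  obtain w' where w': "orthonormal_on UNIV w'" "\<And>i. w' (\<iota> i) = v' i" using ext[OF v'] by blast
  obtain w where w: "orthonormal_on UNIV w" "\<And>i. w (\<iota> i) = b i" using ext[OF b] by blast
  define T where "T = onb_map (outer_family u' w') (outer_family a w)"
  have "T (outer (u' i) (v' i)) = outer (a i) (b i)" for i
    unfolding T_def onb_map_outer by (simp add: onb_map_base u' w' flip: w'(2) w(2))
  then have TX: "T X = (\<Sum>i\<in>UNIV. s i *\<^sub>R outer (a i) (b i))"
    unfolding X T_def by (simp add: linear_sum[OF linear_onb_map] linear_cmul[OF linear_onb_map])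
  have "risk (svst l) X = risk (svst l) (T X)"
    unfolding T_def by (rule risk_svst_rotation[OF card u' a w'(1) w(1), symmetric])
  also have "\<dots> \<le> (SUP k::nat. risk (svst l) (real k *\<^sub>R C))"
    by (rule risk_svst_le_SUP_ray[OF card a b s _ _ TX C']) (use d \<pi>(2) in auto)
  finally show ?thesis .
qed

text \<open>Stated as an inequality it covers the factor zero too, so every multiple of
  \<open>C\<close> competes in the supremum.\<close>

lemma rank_scaleR_le: "rank (c *\<^sub>R A) \<le> rank A" for A :: "real^'n^'m"
proof -
  have "range ((*v) (c *\<^sub>R A)) \<subseteq> range ((*v) A)"
    by (auto simp: scaleR_mult_vec matrix_vector_mult_scaleR[symmetric])
  then show ?thesis unfolding rank_dim_range by (rule dim_subset)
qed

theorem theorem1: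
  fixes lam :: real and r :: nat and C :: "real^'n::finite^'m::finite"
  assumes "lam > 0" and "CARD('m) \<le> CARD('n)"
    and "1 \<le> r" and "r \<le> CARD('m)" and "rank C = r"
  shows "((\<lambda>mu::real. risk (svst lam) (mu *\<^sub>R C)) \<longlongrightarrow>
           (SUP X0 \<in> {X0 :: real^'n^'m. rank X0 \<le> r}. risk (svst lam) X0)) at_top"
proof -
  let ?R = "risk (svst lam) :: real^'n^'m \<Rightarrow> ennreal"
  let ?S = "SUP X0 \<in> {X0. rank X0 \<le> r}. ?R X0"
  have l: "0 \<le> lam" using assms(1) by simp
  have upper: "?R (mu *\<^sub>R C) \<le> ?S" for mu
    using rank_scaleR_le[of mu C] assms(5) by (intro SUP_upper) auto
  have lower: "?S \<le> (SUP k::nat. ?R (real k *\<^sub>R C))"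
    using risk_svst_le_SUP_ray_rank[OF assms(2) l] assms(5) by (intro SUP_least) auto
  show ?thesis
  proof (rule order_tendstoI)
    fix x assume "x < ?S"
    then have "x < (SUP k::nat. ?R (real k *\<^sub>R C))" using lower by (rule order_less_le_trans)
    then obtain k :: nat where k: "x < ?R (real k *\<^sub>R C)" by (auto simp: less_SUP_iff)
    \<comment> \<open>Monotonicity along the ray passes from the integer \<open>k\<close> to all
      larger real factors.\<close>
    have "x < ?R (mu *\<^sub>R C)" if "real k \<le> mu" for mu
      using k risk_svst_mono[OF assms(2) l of_nat_0_le_iff that, of C] by (rule order_less_le_trans)
    then show "\<forall>\<^sub>F mu in at_top. x < ?R (mu *\<^sub>R C)"
      by (rule eventually_at_top_linorderI)
  next
    fix x assume "?S < x"
    then show "\<forall>\<^sub>F mu in at_top. ?R (mu *\<^sub>R C) < x"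
      by (intro always_eventually allI order_le_less_trans[OF upper])
  qed
qed

end
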